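(* Let $f$ be a Boolean function with a stopping tree $\mathcal T$, with set of stopping nodes $\sigma_{\mathcal T}$ and set of branching nodes $\beta_{\mathcal T}$, and suppose that there is $K>0$ such that (i) ${\bf H}(f^\rho)\le K\,{\bf I}(f^\rho)$ at all stopping nodes $\rho\in\sigma_{\mathcal T}$; (ii) $\Delta{\bf H}(f^\rho)\le K\,{\bf I}_{i_\rho}(f^\rho)$ at all branching nodes $\rho\in\beta_{\mathcal T}$. Then ${\bf H}(f)\le K\,{\bf I}(f)$.
   Context: For a finite set $V$, a Boolean function on variables $(x_i)_{i\in V}$ is a function $f:\{-1,1\}^V\to\{-1,1\}$. For $S\subset V$, $\chi_S(x)=\prod_{i\in S}x_i$ and $\widehat f(S)=2^{-|V|}\sum_x f(x)\chi_S(x)$. Define ${\bf I}_m(f)=\sum_{S\ni m}\widehat f(S)^2$ for $m\in V$, ${\bf I}(f)=\sum_{S\subset V}|S|\widehat f(S)^2$, ${\bf H}(f)=\sum_{S\subset V}\widehat f(S)^2\log_2\frac1{\widehat f(S)^2}$ (with $0\log_2(1/0):=0$). Splitting $f$ by $x_m$, $m\in V$, produces $f^{+},f^-:\{-1,1\}^{V\setminus\{m\}}\to\{-1,1\}$ obtained by setting $x_m=+1$, resp. $-1$; relative to the splitting variable, $\Delta{\bf H}(f)={\bf H}(f)-\frac12[{\bf H}(f^+)+{\bf H}(f^-)]$. A stopping (binary decision) tree of $f$ is a finite rooted binary tree in which each node $\rho$ carries a Boolean function $f^\rho$; the root carries $f$; each non-terminal node (branching node) $\rho$ also carries a label $i_\rho$,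 one of the variables on which $f^\rho$ is defined (so no variable repeats along a path), and its two children carry $(f^\rho)^+$ and $(f^\rho)^-$, the functions obtained by splitting $f^\rho$ by $x_{i_\rho}$. The terminal nodes are the stopping nodes; the functions there need not be constant. In (ii), $\Delta{\bf H}(f^\rho)$ is computed with splitting variable $x_{i_\rho}$. *)

theory Defs
  imports Complex_Main "HOL-Library.FuncSet"
begin

(* Points of the cube are extensional: undefined outside V. Hence if m is in V, updating a point of
   cube (V - {m}) at m gives a point of cube V. *)
definition cube :: "'a set \<Rightarrow> ('a \<Rightarrow> real) set" where
  "cube V = (V \<rightarrow>\<^sub>E {-1, 1})"

(* The values of f off cube V are irrelevant, since every quantity below that depends on f only
   evaluates it on cube V. *)
definition boolean_function :: "'a set \<Rightarrow> (('a \<Rightarrow> real) \<Rightarrow> real) \<Rightarrow> bool" where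
  "boolean_function V f \<longleftrightarrow> f \<in> cube V \<rightarrow> {-1, 1}"

definition chi :: "'a set \<Rightarrow> ('a \<Rightarrow> real) \<Rightarrow> real" where
  "chi S x = (\<Prod>i\<in>S. x i)"

definition fourier_coeff :: "'a set \<Rightarrow> (('a \<Rightarrow> real) \<Rightarrow> real) \<Rightarrow> 'a set \<Rightarrow> real" where
  "fourier_coeff V f S = (\<Sum>x\<in>cube V. f x * chi S x) / 2 ^ card V"

definition influence :: "'a set \<Rightarrow> (('a \<Rightarrow> real) \<Rightarrow> real) \<Rightarrow> 'a \<Rightarrow> real" where
  "influence V f m = (\<Sum>S | S \<subseteq> V \<and> m \<in> S. (fourier_coeff V f S)\<^sup>2)"

definition total_influence :: "'a set \<Rightarrow> (('a \<Rightarrow> real) \<Rightarrow> real) \<Rightarrow> real" where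
  "total_influence V f = (\<Sum>S\<in>Pow V. real (card S) * (fourier_coeff V f S)\<^sup>2)"

(* Summands with a vanishing coefficient are 0, as the left factor is 0. *)
definition fourier_entropy :: "'a set \<Rightarrow> (('a \<Rightarrow> real) \<Rightarrow> real) \<Rightarrow> real" where
  "fourier_entropy V f =
     (\<Sum>S\<in>Pow V. (fourier_coeff V f S)\<^sup>2 * log 2 (1 / (fourier_coeff V f S)\<^sup>2))"

definition set_var :: "'a \<Rightarrow> real \<Rightarrow> (('a \<Rightarrow> real) \<Rightarrow> real) \<Rightarrow> (('a \<Rightarrow> real) \<Rightarrow> real)" where
  "set_var m b f = (\<lambda>x. f (x(m := b)))"

definition delta_entropy :: "'a set \<Rightarrow> (('a \<Rightarrow> real) \<Rightarrow> real) \<Rightarrow> 'a \<Rightarrow> real" where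
  "delta_entropy V f m = fourier_entropy V f
     - (fourier_entropy (V - {m}) (set_var m 1 f) + fourier_entropy (V - {m}) (set_var m (-1) f)) / 2"

(* Only the labels are stored: together with the function at the root they determine the function
   at every node. The first subtree of Branch corresponds to the value +1, the second to -1. *)
datatype 'a dtree = Stop | Branch 'a "'a dtree" "'a dtree"

primrec stopping_tree :: "'a set \<Rightarrow> 'a dtree \<Rightarrow> bool" where
  "stopping_tree V Stop \<longleftrightarrow> True"
| "stopping_tree V (Branch i l r) \<longleftrightarrow>
     i \<in> V \<and> stopping_tree (V - {i}) l \<and> stopping_tree (V - {i}) r"

(* For the tree with root function f on V: the pairs (variable set, function) carried by the
   stopping nodes. *)
primrec stopping_nodes ::
  "'a set \<Rightarrow> (('a \<Rightarrow> real) \<Rightarrow> real) \<Rightarrow> 'a dtree \<Rightarrow> ('a set \<times> (('a \<Rightarrow> real) \<Rightarrow> real)) set" where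
  "stopping_nodes V f Stop = {(V, f)}"
| "stopping_nodes V f (Branch i l r) =
     stopping_nodes (V - {i}) (set_var i 1 f) l \<union> stopping_nodes (V - {i}) (set_var i (-1) f) r"

(* The triples (variable set, function, label) carried by the branching nodes. *)
primrec branching_nodes ::
  "'a set \<Rightarrow> (('a \<Rightarrow> real) \<Rightarrow> real) \<Rightarrow> 'a dtree \<Rightarrow> ('a set \<times> (('a \<Rightarrow> real) \<Rightarrow> real) \<times> 'a) set" where
  "branching_nodes V f Stop = {}"
| "branching_nodes V f (Branch i l r) =
     insert (V, f, i)
       (branching_nodes (V - {i}) (set_var i 1 f) l \<union> branching_nodes (V - {i}) (set_var i (-1) f) r)"

end

theory Submission imports Defs begin

text \<open>The total influence obeys an exact recursion under splitting by a variable m: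
  it equals the influence of m plus the average of the total influences of the two restrictions.
  The reason is that the coefficients of f at S and at S with m added are the half sum and the half
  difference of the coefficients of the restrictions at S, so by the parallelogram law the weight of
  f on this pair of sets is the average of the weights of the restrictions at S; the set containing
  m has one more element, and these extra units add up to the influence of m
  (lemma \<open>total_influence_split\<close>).

  The entropy, by definition of its drop, satisfies the same recursion with the entropy drop in place
  of the influence of m. Hence the hypothesis at the branching nodes is just what is needed to carry
  the inequality between entropy and influence from the children of a node to the node itself, and
  induction on the tree, started at the stopping nodes, carries it to the root.\<close>

lemma sum_cube_insert:
  assumes "m \<notin> W"
  shows "(\<Sum>x\<in>cube (insert m W). F x) = (\<Sum>x\<in>cube W. F (x(m := 1)) + F (x(m := -1)))"
proof -
  have cube: "cube (insert m W) = (\<lambda>(b, x). x(m := b)) ` ({-1, 1} \<times> cube W)"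
    unfolding cube_def by (rule PiE_insert_eq)
  have inj: "inj_on (\<lambda>(b, x). x(m := b)) ({-1, 1} \<times> cube W)"
    unfolding cube_def using inj_combinator[OF assms, of "\<lambda>_. {-1, 1::real}"] by simp
  have "(\<Sum>x\<in>cube (insert m W). F x) = (\<Sum>(b, x)\<in>{-1, 1} \<times> cube W. F (x(m := b)))"
    unfolding cube by (subst sum.reindex[OF inj]) (simp add: case_prod_unfold)
  also have "\<dots> = (\<Sum>b\<in>{-1, 1}. \<Sum>x\<in>cube W. F (x(m := b)))"
    by (rule sum.cartesian_product[symmetric])
  also have "\<dots> = (\<Sum>x\<in>cube W. F (x(m := 1)) + F (x(m := -1)))"
    by (simp add: sum.distrib add.commute)
  finally show ?thesis .
qed

lemma chi_update_notin: "m \<notin> S \<Longrightarrow> chi S (x(m := b)) = chi S x"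
  unfolding chi_def by (rule prod.cong) auto

lemma chi_insert_update:
  "finite S \<Longrightarrow> m \<notin> S \<Longrightarrow> chi (insert m S) (x(m := b)) = b * chi S x"
  using chi_update_notin[of m S x b] by (simp add: chi_def)

lemma fourier_coeff_split:
  assumes "finite W" "m \<notin> W" "S \<subseteq> W"
  shows fourier_coeff_split_notin: "fourier_coeff (insert m W) f S =
      (fourier_coeff W (set_var m 1 f) S + fourier_coeff W (set_var m (-1) f) S) / 2"
    and fourier_coeff_split_in: "fourier_coeff (insert m W) f (insert m S) =
      (fourier_coeff W (set_var m 1 f) S - fourier_coeff W (set_var m (-1) f) S) / 2"
proof -
  have S: "finite S" "m \<notin> S"
    using assms finite_subset by auto
  show "fourier_coeff (insert m W) f S =
      (fourier_coeff W (set_var m 1 f) S + fourier_coeff W (set_var m (-1) f) S) / 2"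
    using assms S
    by (simp add: fourier_coeff_def sum_cube_insert chi_update_notin set_var_def sum.distrib
        add_divide_distrib)
  show "fourier_coeff (insert m W) f (insert m S) =
      (fourier_coeff W (set_var m 1 f) S - fourier_coeff W (set_var m (-1) f) S) / 2"
    using assms S
    by (simp add: fourier_coeff_def sum_cube_insert chi_insert_update set_var_def sum_subtractf
        diff_divide_distrib)
qed

lemma inj_on_insert_Pow: "m \<notin> W \<Longrightarrow> inj_on (insert m) (Pow W)"
  by (auto simp: inj_on_def)

lemma sum_Pow_insert:
  assumes "finite W" "m \<notin> W"
  shows "(\<Sum>S\<in>Pow (insert m W). F S) = (\<Sum>S\<in>Pow W. F S + F (insert m S))"
proof -
  have "(\<Sum>S\<in>Pow (insert m W). F S) = (\<Sum>S\<in>Pow W. F S) + (\<Sum>S\<in>insert m ` Pow W. F S)"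
    unfolding Pow_insert using assms by (intro sum.union_disjoint) auto
  also have "(\<Sum>S\<in>insert m ` Pow W. F S) = (\<Sum>S\<in>Pow W. F (insert m S))"
    using sum.reindex[OF inj_on_insert_Pow[OF assms(2)], of F] by simp
  finally show ?thesis
    by (simp add: sum.distrib)
qed

lemma influence_insert:
  assumes "m \<notin> W"
  shows "influence (insert m W) f m = (\<Sum>S\<in>Pow W. (fourier_coeff (insert m W) f (insert m S))\<^sup>2)"
proof -
  have "{S. S \<subseteq> insert m W \<and> m \<in> S} = insert m ` Pow W"
    unfolding image_def using assms by (auto intro!: bexI[of _ "_ - {m}"])
  then show ?thesis
    unfolding influence_def by (simp add: sum.reindex[OF inj_on_insert_Pow[OF assms]])
qed

text \<open>Pair each set avoiding m with the set obtained by adding m. The squared coefficients of a pair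
  sum to the average of those of the restrictions, since
  ((a + b) / 2)^2 + ((a - b) / 2)^2 = (a^2 + b^2) / 2.\<close>
lemma total_influence_split:
  assumes "finite V" "m \<in> V"
  shows "total_influence V f = influence V f m +
    (total_influence (V - {m}) (set_var m 1 f) + total_influence (V - {m}) (set_var m (-1) f)) / 2"
proof -
  define W where "W = V - {m}"
  have V: "V = insert m W" and W: "finite W" "m \<notin> W"
    using assms by (auto simp: W_def)
  let ?c = "fourier_coeff V f"
  let ?a = "fourier_coeff W (set_var m 1 f)" and ?b = "fourier_coeff W (set_var m (-1) f)"
  have pair: "real (card S) * (?c S)\<^sup>2 + real (card (insert m S)) * (?c (insert m S))\<^sup>2
      = (?c (insert m S))\<^sup>2 + (real (card S) * (?a S)\<^sup>2 + real (card S) * (?b S)\<^sup>2) / 2"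
    if "S \<in> Pow W" for S
  proof -
    have S: "S \<subseteq> W" "finite S" "m \<notin> S"
      using that W finite_subset by auto
    have "(?c S)\<^sup>2 + (?c (insert m S))\<^sup>2 = ((?a S)\<^sup>2 + (?b S)\<^sup>2) / 2"
      unfolding V fourier_coeff_split[OF W S(1)] by (simp add: power2_eq_square field_simps)
    then have "real (card S) * ((?c S)\<^sup>2 + (?c (insert m S))\<^sup>2)
        = real (card S) * (((?a S)\<^sup>2 + (?b S)\<^sup>2) / 2)"
      by simp
    then show ?thesis
      using S by (simp add: algebra_simps add_divide_distrib)
  qed
  have "total_influence V f = (\<Sum>S\<in>Pow W. real (card S) * (?c S)\<^sup>2
      + real (card (insert m S)) * (?c (insert m S))\<^sup>2)"
    unfolding total_influence_def by (subst V) (rule sum_Pow_insert[OF W])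
  also have "\<dots> = (\<Sum>S\<in>Pow W. (?c (insert m S))\<^sup>2
      + (real (card S) * (?a S)\<^sup>2 + real (card S) * (?b S)\<^sup>2) / 2)"
    by (rule sum.cong[OF refl pair])
  also have "\<dots> = influence V f m
      + (total_influence W (set_var m 1 f) + total_influence W (set_var m (-1) f)) / 2"
    unfolding total_influence_def
    by (simp add: V influence_insert[OF W(2)] sum.distrib sum_divide_distrib[symmetric])
  finally show ?thesis
    unfolding W_def .
qed

theorem mainTheorem3:
  fixes V :: "'a set" and f :: "('a \<Rightarrow> real) \<Rightarrow> real" and T :: "'a dtree" and K :: real
  assumes "finite V"
    and "boolean_function V f"
    and "stopping_tree V T"
    and "K > 0"
    and "\<forall>(W, g) \<in> stopping_nodes V f T. fourier_entropy W g \<le> K * total_influence W g"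
    and "\<forall>(W, g, i) \<in> branching_nodes V f T. delta_entropy W g i \<le> K * influence W g i"
  shows "fourier_entropy V f \<le> K * total_influence V f"
  using assms(1,3,5,6)
proof (induction T arbitrary: V f)
  case Stop
  then show ?case by simp
next
  case (Branch i l r)
  let ?V = "V - {i}" and ?p = "set_var i 1 f" and ?n = "set_var i (-1) f"
  have p: "fourier_entropy ?V ?p \<le> K * total_influence ?V ?p"
    using Branch.prems by (intro Branch.IH(1)) auto
  have n: "fourier_entropy ?V ?n \<le> K * total_influence ?V ?n"
    using Branch.prems by (intro Branch.IH(2)) auto
  have drop: "delta_entropy V f i \<le> K * influence V f i"
    using Branch.prems by simp
  have "fourier_entropy V f
      = delta_entropy V f i + (fourier_entropy ?V ?p + fourier_entropy ?V ?n) / 2"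
    by (simp add: delta_entropy_def)
  also have "\<dots> \<le> K * influence V f i + (K * total_influence ?V ?p + K * total_influence ?V ?n) / 2"
    by (intro add_mono divide_right_mono p n drop) simp
  also have "\<dots> = K * total_influence V f"
    using Branch.prems total_influence_split[of V i f]
    by (simp add: distrib_left add_divide_distrib)
  finally show ?case .
qed

end
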